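(* Assume that $T$ is continuous on $C$, that $S_*\neq\varnothing$ and that $S_*\subseteq S_{\rm dual}$. Let $(x^k)_{k\in\mathbb{N}}$ be an infinite sequence generated by Conceptual Algorithm F with Variant F.3, that is, $x^{k+1}=P_{C\cap H(\overline{x}^k,\bar v^k)\cap W(x^k)}(x^0)$, such that $x^k\notin S_*$ for all $k\in\mathbb{N}$. Then $(x^k)_{k\in\mathbb{N}}$ converges to $P_{S_*}(x^0)$.
   Context: $\mathbb{R}^n$ carries the Euclidean inner product $\langle\cdot,\cdot\rangle$ and norm $\|\cdot\|$; $\mathbb{N}=\{0,1,2,\dots\}$. $T:\operatorname{dom}(T)\subseteq\mathbb{R}^n\to\mathbb{R}^n$ is an operator and $C\subseteq\operatorname{dom}(T)$ is nonempty, closed and convex. $P_S$ is the orthogonal projection onto a nonempty closed convex set $S$ (under the hypotheses of the claim, $S_*$ is closed and convex). For $x\in C$, $\mathcal{N}_C(x)=\{u\in\mathbb{R}^n:\langle u,y-x\rangle\le 0\ \forall y\in C\}$. $S_*=\{x_*\in C:\langle T(x_* ),x-x_*\rangle\ge0\ \forall x\in C\}$ and $S_{\rm dual}=\{x_*\in C:\langle T(x),x-x_*\rangle\ge0\ \forall x\in C\}$. For $z\in C$ and $v\in\mathcal{N}_C(z)$, $H(z,v)=\{y\in\mathbb{R}^n:\langle T(z)+v,y-z\rangle\le0\}$. With $x^0$ the starting point, $W(x)=\{y\in\mathbb{R}^n:\langle y-x,x^0-x\rangle\le0\}$. Conceptual Algorithm F. Fix $(\beta_k)_{k\in\mathbb{N}}\subset[\check\beta,\hat\beta]$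 with $0<\check\beta\le\hat\beta<+\infty$, $\delta,\theta\in(0,1)$, $M>0$. Linesearch F, for input $x\in C$, $u\in\mathcal{N}_C(x)$, $\beta>0$: start with $\alpha=1$. For each trial $\alpha$ let $z_\alpha=P_C(x-\beta(T(x)+\alpha u))$ and choose any $v_\alpha\in\mathcal{N}_C(\alpha z_\alpha+(1-\alpha)x)$ with $\|v_\alpha\|\le M$. While $\langle T(\alpha z_\alpha+(1-\alpha)x)+v_\alpha,\,x-z_\alpha\rangle<\delta\langle T(x)+\alpha u,\,x-z_\alpha\rangle$, replace $\alpha$ by $\theta\alpha$ (and choose a new such $v_\alpha$). Output $(\alpha,z_\alpha,v_\alpha)$. Algorithm: take $x^0\in C$. At iteration $k$, stop if $x^k=P_C(x^k-T(x^k))$. Otherwise choose any $u^k\in\mathcal{N}_C(x^k)$ with $\|u^k\|\le M$, let $(\alpha_k,z^k,\bar v^k)$ be the output of Linesearch F for input $(x^k,u^k,\beta_k)$, set $\overline{x}^k=\alpha_kz^k+(1-\alpha_k)x^k$, and compute $x^{k+1}$ by the update rule of the chosen variant. *)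

theory Defs
  imports "HOL-Analysis.Analysis"
begin

text \<open>
  The operator \<open>T\<close> is rendered as a total function; only its values on the feasible set \<open>C\<close>
  are ever used below.  The orthogonal projection \<open>P\<^sub>S(a)\<close> is the library's \<open>closest_point S a\<close>.
\<close>

definition normal_cone :: "(real ^ 'n) set \<Rightarrow> real ^ 'n \<Rightarrow> (real ^ 'n) set" where
  "normal_cone C x = {u. \<forall>y\<in>C. u \<bullet> (y - x) \<le> 0}"

definition sol_set :: "(real ^ 'n \<Rightarrow> real ^ 'n) \<Rightarrow> (real ^ 'n) set \<Rightarrow> (real ^ 'n) set" where
  "sol_set T C = {s \<in> C. \<forall>x\<in>C. T s \<bullet> (x - s) \<ge> 0}"

definition dual_sol_set :: "(real ^ 'n \<Rightarrow> real ^ 'n) \<Rightarrow> (real ^ 'n) set \<Rightarrow> (real ^ 'n) set" where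
  "dual_sol_set T C = {s \<in> C. \<forall>x\<in>C. T x \<bullet> (x - s) \<ge> 0}"

definition H_half :: "(real ^ 'n \<Rightarrow> real ^ 'n) \<Rightarrow> real ^ 'n \<Rightarrow> real ^ 'n \<Rightarrow> (real ^ 'n) set" where
  "H_half T z v = {y. (T z + v) \<bullet> (y - z) \<le> 0}"

definition W_half :: "real ^ 'n \<Rightarrow> real ^ 'n \<Rightarrow> (real ^ 'n) set" where
  "W_half x0 x = {y. (y - x) \<bullet> (x0 - x) \<le> 0}"

definition ls_z ::
    "(real ^ 'n \<Rightarrow> real ^ 'n) \<Rightarrow> (real ^ 'n) set \<Rightarrow> real ^ 'n \<Rightarrow> real ^ 'n \<Rightarrow> real \<Rightarrow> real \<Rightarrow> real ^ 'n" where
  "ls_z T C x u \<beta> \<alpha> = closest_point C (x - \<beta> *\<^sub>R (T x + \<alpha> *\<^sub>R u))"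

definition ls_point ::
    "(real ^ 'n \<Rightarrow> real ^ 'n) \<Rightarrow> (real ^ 'n) set \<Rightarrow> real ^ 'n \<Rightarrow> real ^ 'n \<Rightarrow> real \<Rightarrow> real \<Rightarrow> real ^ 'n" where
  "ls_point T C x u \<beta> \<alpha> = \<alpha> *\<^sub>R ls_z T C x u \<beta> \<alpha> + (1 - \<alpha>) *\<^sub>R x"

text \<open>The condition under which the backtracking loop continues.\<close>

definition ls_continue ::
    "(real ^ 'n \<Rightarrow> real ^ 'n) \<Rightarrow> (real ^ 'n) set \<Rightarrow> real \<Rightarrow> real ^ 'n \<Rightarrow> real ^ 'n \<Rightarrow> real
      \<Rightarrow> real \<Rightarrow> real ^ 'n \<Rightarrow> bool" where
  "ls_continue T C \<delta> x u \<beta> \<alpha> v \<longleftrightarrow>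
     (T (ls_point T C x u \<beta> \<alpha>) + v) \<bullet> (x - ls_z T C x u \<beta> \<alpha>)
       < \<delta> * ((T x + \<alpha> *\<^sub>R u) \<bullet> (x - ls_z T C x u \<beta> \<alpha>))"

text \<open>
  \<open>ls_trial \<dots> \<alpha> v\<close>: some run of Linesearch F on input \<open>(x, u, \<beta>)\<close> reaches the trial stepsize \<open>\<alpha>\<close>
  and picks the normal vector \<open>v\<close> there.  The choice of \<open>v\<close> is nondeterministic and is made
  afresh at every trial.
\<close>

inductive ls_trial ::
    "(real ^ 'n \<Rightarrow> real ^ 'n) \<Rightarrow> (real ^ 'n) set \<Rightarrow> real \<Rightarrow> real \<Rightarrow> real
      \<Rightarrow> real ^ 'n \<Rightarrow> real ^ 'n \<Rightarrow> real \<Rightarrow> real \<Rightarrow> real ^ 'n \<Rightarrow> bool"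
  for T C \<delta> \<theta> M x u \<beta>
where
  start: "\<lbrakk>v \<in> normal_cone C (ls_point T C x u \<beta> 1); norm v \<le> M\<rbrakk>
            \<Longrightarrow> ls_trial T C \<delta> \<theta> M x u \<beta> 1 v"
| backtrack: "\<lbrakk>ls_trial T C \<delta> \<theta> M x u \<beta> \<alpha> v; ls_continue T C \<delta> x u \<beta> \<alpha> v;
               w \<in> normal_cone C (ls_point T C x u \<beta> (\<theta> * \<alpha>)); norm w \<le> M\<rbrakk>
            \<Longrightarrow> ls_trial T C \<delta> \<theta> M x u \<beta> (\<theta> * \<alpha>) w"

definition linesearch_F ::
    "(real ^ 'n \<Rightarrow> real ^ 'n) \<Rightarrow> (real ^ 'n) set \<Rightarrow> real \<Rightarrow> real \<Rightarrow> real
      \<Rightarrow> real ^ 'n \<Rightarrow> real ^ 'n \<Rightarrow> real \<Rightarrow> real \<Rightarrow> real ^ 'n \<Rightarrow> real ^ 'n \<Rightarrow> bool" where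
  "linesearch_F T C \<delta> \<theta> M x u \<beta> \<alpha> z v \<longleftrightarrow>
     ls_trial T C \<delta> \<theta> M x u \<beta> \<alpha> v \<and> \<not> ls_continue T C \<delta> x u \<beta> \<alpha> v \<and> z = ls_z T C x u \<beta> \<alpha>"

text \<open>
  \<open>x\<close> is an infinite sequence generated by Conceptual Algorithm F; \<open>upd x0 xk xbar vbar\<close> is the
  next iterate prescribed by the chosen variant.
\<close>

definition conceptual_algorithm_F ::
    "(real ^ 'n \<Rightarrow> real ^ 'n) \<Rightarrow> (real ^ 'n) set \<Rightarrow> (nat \<Rightarrow> real) \<Rightarrow> real \<Rightarrow> real \<Rightarrow> real
      \<Rightarrow> (real ^ 'n \<Rightarrow> real ^ 'n \<Rightarrow> real ^ 'n \<Rightarrow> real ^ 'n \<Rightarrow> real ^ 'n)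
      \<Rightarrow> (nat \<Rightarrow> real ^ 'n) \<Rightarrow> bool" where
  "conceptual_algorithm_F T C \<beta> \<delta> \<theta> M upd x \<longleftrightarrow>
     x 0 \<in> C \<and>
     (\<forall>k. x k \<noteq> closest_point C (x k - T (x k)) \<and>
       (\<exists>u \<alpha> z v. u \<in> normal_cone C (x k) \<and> norm u \<le> M \<and>
          linesearch_F T C \<delta> \<theta> M (x k) u (\<beta> k) \<alpha> z v \<and>
          x (Suc k) = upd (x 0) (x k) (\<alpha> *\<^sub>R z + (1 - \<alpha>) *\<^sub>R x k) v))"

definition variant_F3 ::
    "(real ^ 'n \<Rightarrow> real ^ 'n) \<Rightarrow> (real ^ 'n) set
      \<Rightarrow> real ^ 'n \<Rightarrow> real ^ 'n \<Rightarrow> real ^ 'n \<Rightarrow> real ^ 'n \<Rightarrow> real ^ 'n" where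
  "variant_F3 T C x0 xk xbar vbar = closest_point (C \<inter> H_half T xbar vbar \<inter> W_half x0 xk) x0"

end

theory Submission
  imports Defs
begin

text \<open>
  Every solution lies in all the half-spaces \<open>H\<close> and \<open>W\<close>, so the distance of the iterates to the
  starting point increases and is bounded by that of the solution set; hence consecutive iterates
  get arbitrarily close.  Along a subsequence all the data converge.  If the limiting stepsize is
  positive, membership of the next iterate in \<open>H\<close> makes the projection residual vanish in the
  limit; if it is zero, the last rejected trial does.  So some cluster point is a solution, which
  forces the distances to converge to that of the nearest solution \<open>p\<close>, and
  \<open>p \<in> W(x\<^sup>k)\<close> then gives \<open>\<parallel>p - x\<^sup>k\<parallel>\<^sup>2 \<le> \<parallel>p - x\<^sup>0\<parallel>\<^sup>2 - \<parallel>x\<^sup>k - x\<^sup>0\<parallel>\<^sup>2 \<rightarrow> 0\<close>.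
\<close>

section \<open>Stability of normal cones and of the solution set under limits\<close>

lemma normal_cone_limit:
  assumes "X \<longlonglongrightarrow> x" "U \<longlonglongrightarrow> u" and N: "\<And>k. U k \<in> normal_cone C (X k)"
  shows "u \<in> normal_cone C x"
  unfolding normal_cone_def
proof (intro CollectI ballI)
  fix y assume "y \<in> C"
  have "(\<lambda>k. U k \<bullet> (y - X k)) \<longlonglongrightarrow> u \<bullet> (y - x)"
    by (intro tendsto_intros assms)
  then show "u \<bullet> (y - x) \<le> 0"
    using N \<open>y \<in> C\<close> by (intro LIMSEQ_le_const2) (auto simp: normal_cone_def)
qed

text \<open>Closedness ensures that the distance from the starting point to the solution set is
  attained, so that \<open>closest_point\<close> really returns a solution.\<close>

lemma closed_sol_set:
  assumes "closed C" "continuous_on C T"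
  shows "closed (sol_set T C)"
proof -
  have "s \<in> sol_set T C" if s: "\<And>k. S k \<in> sol_set T C" and lim: "S \<longlonglongrightarrow> s" for S s
  proof -
    have SC: "\<And>k. S k \<in> C"
      using s by (auto simp: sol_set_def)
    then have "s \<in> C"
      using lim \<open>closed C\<close> closed_sequentially by blast
    have "T s \<bullet> (y - s) \<ge> 0" if "y \<in> C" for y
    proof -
      have "(\<lambda>k. T (S k)) \<longlonglongrightarrow> T s"
        using continuous_on_tendsto_compose[OF assms(2) lim \<open>s \<in> C\<close>] SC by simp
      then have "(\<lambda>k. T (S k) \<bullet> (y - S k)) \<longlonglongrightarrow> T s \<bullet> (y - s)"
        by (intro tendsto_intros lim)
      then show ?thesis
        using s \<open>y \<in> C\<close> by (intro LIMSEQ_le_const) (auto simp: sol_set_def)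
    qed
    with \<open>s \<in> C\<close> show ?thesis by (simp add: sol_set_def)
  qed
  then show ?thesis
    unfolding closed_sequential_limits by blast
qed

section \<open>Trial points and stepsizes of the linesearch\<close>

lemma ls_z_mem:
  assumes "closed C" "C \<noteq> {}"
  shows "ls_z T C x u \<beta> \<alpha> \<in> C"
  using assms by (simp add: ls_z_def closest_point_in_set)

lemma ls_point_mem:
  assumes "closed C" "convex C" "x \<in> C" "0 \<le> \<alpha>" "\<alpha> \<le> 1"
  shows "ls_point T C x u \<beta> \<alpha> \<in> C"
  unfolding ls_point_def using assms ls_z_mem[of C T x u \<beta> \<alpha>]
  by (intro convexD) auto

text \<open>The obtuse-angle property of the projection, tested at \<open>x\<close> itself. It turns
  an upper bound on the inner product in the linesearch test into a bound on the residual
  \<open>x - z\<close>.\<close>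

lemma norm_ls_z_le:
  assumes "closed C" "convex C" "x \<in> C"
  shows "(norm (x - ls_z T C x u \<beta> \<alpha>))\<^sup>2
           \<le> \<beta> * ((T x + \<alpha> *\<^sub>R u) \<bullet> (x - ls_z T C x u \<beta> \<alpha>))"
proof -
  define g where "g = T x + \<alpha> *\<^sub>R u"
  define z where "z = ls_z T C x u \<beta> \<alpha>"
  have "((x - \<beta> *\<^sub>R g) - z) \<bullet> (x - z) \<le> 0"
    using closest_point_dot[OF assms(2,1,3)] by (simp add: g_def z_def ls_z_def)
  moreover have "(x - \<beta> *\<^sub>R g) - z = (x - z) - \<beta> *\<^sub>R g"
    by simp
  ultimately have "(norm (x - z))\<^sup>2 \<le> \<beta> * (g \<bullet> (x - z))"
    by (simp add: inner_diff_left[of "x - z"] dot_square_norm)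
  then show ?thesis
    by (simp add: g_def z_def)
qed

text \<open>The projection inequality at a fixed point says that
  \<open>T x + \<alpha> *\<^sub>R u\<close> has nonnegative inner product with every
  \<open>y - x\<close>. The normal \<open>u\<close> contributes a nonpositive amount to it, so
  \<open>T x\<close> alone already has this property.\<close>

lemma ls_z_fixed_imp_sol:
  assumes C: "closed C" "convex C" "x \<in> C" and "\<beta> > 0" "\<alpha> \<ge> 0"
    and u: "u \<in> normal_cone C x" and fixed: "ls_z T C x u \<beta> \<alpha> = x"
  shows "x \<in> sol_set T C"
proof -
  have "T x \<bullet> (y - x) \<ge> 0" if "y \<in> C" for y
  proof -
    have "(x - \<beta> *\<^sub>R (T x + \<alpha> *\<^sub>R u) - x) \<bullet> (y - x) \<le> 0"
      using closest_point_dot[OF C(2,1) \<open>y \<in> C\<close>, of "x - \<beta> *\<^sub>R (T x + \<alpha> *\<^sub>R u)"] fixed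
      by (simp add: ls_z_def)
    then have "\<beta> * ((T x + \<alpha> *\<^sub>R u) \<bullet> (y - x)) \<ge> 0"
      by (simp add: algebra_simps)
    then have "(T x + \<alpha> *\<^sub>R u) \<bullet> (y - x) \<ge> 0"
      using \<open>\<beta> > 0\<close> by (simp add: zero_le_mult_iff)
    moreover have "\<alpha> * (u \<bullet> (y - x)) \<le> 0"
      using u \<open>y \<in> C\<close> \<open>\<alpha> \<ge> 0\<close> by (auto simp: normal_cone_def intro: mult_nonneg_nonpos)
    ultimately show ?thesis
      by (simp add: inner_add_left)
  qed
  with C(3) show ?thesis by (simp add: sol_set_def)
qed

lemma tendsto_ls_z:
  assumes C: "closed C" "convex C" and T: "continuous_on C T"
    and x: "X \<longlonglongrightarrow> x" "\<And>k. X k \<in> C" "x \<in> C"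
    and lims: "U \<longlonglongrightarrow> u" "B \<longlonglongrightarrow> \<beta>" "A \<longlonglongrightarrow> \<alpha>"
  shows "(\<lambda>k. ls_z T C (X k) (U k) (B k) (A k)) \<longlonglongrightarrow> ls_z T C x u \<beta> \<alpha>"
proof -
  have "(\<lambda>k. T (X k)) \<longlonglongrightarrow> T x"
    using continuous_on_tendsto_compose[OF T x(1) x(3)] x(2) by simp
  then have "(\<lambda>k. X k - B k *\<^sub>R (T (X k) + A k *\<^sub>R U k)) \<longlonglongrightarrow> x - \<beta> *\<^sub>R (T x + \<alpha> *\<^sub>R u)"
    by (intro tendsto_intros lims x(1))
  moreover have "continuous_on UNIV (closest_point C)"
    using C x(3) by (intro continuous_on_closest_point) auto
  ultimately show ?thesis
    unfolding ls_z_def using continuous_on_tendsto_compose[of UNIV "closest_point C"] by simp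
qed

lemma tendsto_ls_point:
  assumes "closed C" "convex C" "continuous_on C T"
    and "X \<longlonglongrightarrow> x" "\<And>k. X k \<in> C" "x \<in> C"
    and "U \<longlonglongrightarrow> u" "B \<longlonglongrightarrow> \<beta>" "A \<longlonglongrightarrow> \<alpha>"
  shows "(\<lambda>k. ls_point T C (X k) (U k) (B k) (A k)) \<longlonglongrightarrow> ls_point T C x u \<beta> \<alpha>"
  unfolding ls_point_def by (intro tendsto_intros tendsto_ls_z assms)

text \<open>The last alternative looks back one trial: a stepsize other than 1 was reached because
  \<open>\<alpha> / \<theta>\<close> had been rejected with some normal \<open>w\<close>. The bound
  \<open>\<alpha> \<le> \<theta>\<close> keeps that earlier stepsize at most 1, hence its trial
  point in \<open>C\<close>.\<close>

lemma ls_trial_cases: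
  assumes "ls_trial T C \<delta> \<theta> M x u \<beta> \<alpha> v" "0 < \<theta>" "\<theta> < 1"
  shows "0 < \<alpha>" "\<alpha> \<le> 1" "v \<in> normal_cone C (ls_point T C x u \<beta> \<alpha>)" "norm v \<le> M"
    "\<alpha> = 1 \<or> \<alpha> \<le> \<theta> \<and> (\<exists>w \<in> normal_cone C (ls_point T C x u \<beta> (\<alpha> / \<theta>)).
        norm w \<le> M \<and> ls_continue T C \<delta> x u \<beta> (\<alpha> / \<theta>) w)"
proof -
  have "0 < \<alpha> \<and> \<alpha> \<le> 1 \<and> v \<in> normal_cone C (ls_point T C x u \<beta> \<alpha>) \<and> norm v \<le> M \<and>
    (\<alpha> = 1 \<or> \<alpha> \<le> \<theta> \<and> (\<exists>w \<in> normal_cone C (ls_point T C x u \<beta> (\<alpha> / \<theta>)).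
        norm w \<le> M \<and> ls_continue T C \<delta> x u \<beta> (\<alpha> / \<theta>) w))"
    using assms(1)
  proof induction
    case (start v)
    then show ?case by simp
  next
    case (backtrack \<alpha> v w)
    have "\<theta> * \<alpha> \<le> \<theta>" "0 < \<theta> * \<alpha>"
      using backtrack.IH assms(2) by (auto simp: mult_le_cancel_left1)
    moreover from this have "\<theta> * \<alpha> \<le> 1"
      using assms(3) by linarith
    \<comment> \<open>Since \<open>\<theta> * \<alpha> / \<theta> = \<alpha>\<close>, the normal
      \<open>v\<close> of the trial just rejected is the witness.\<close>
    ultimately show ?case
      using backtrack assms(2,3) by auto
  qed
  then show "0 < \<alpha>" "\<alpha> \<le> 1" "v \<in> normal_cone C (ls_point T C x u \<beta> \<alpha>)" "norm v \<le> M"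
    "\<alpha> = 1 \<or> \<alpha> \<le> \<theta> \<and> (\<exists>w \<in> normal_cone C (ls_point T C x u \<beta> (\<alpha> / \<theta>)).
        norm w \<le> M \<and> ls_continue T C \<delta> x u \<beta> (\<alpha> / \<theta>) w)"
    by blast+
qed

section \<open>Limits of linesearch data are solutions\<close>

text \<open>Here \<open>Y\<close> stands for the next iterates. Acceptance bounds the inner product
  with \<open>X - P\<close> from below by a multiple of the decrease term. Membership of
  \<open>Y\<close> in \<open>H\<close> bounds it from above by an inner product with
  \<open>X - Y\<close>, which vanishes in the limit. A positive limit stepsize can then be divided
  out.\<close>

lemma limit_sol_of_positive_step:
  assumes C: "closed C" "convex C" and T: "continuous_on C T"
    and X: "X \<longlonglongrightarrow> x" "\<And>k. X k \<in> C" and Y: "(\<lambda>k. X k - Y k) \<longlonglongrightarrow> 0"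
    and lims: "U \<longlonglongrightarrow> u" "B \<longlonglongrightarrow> \<beta>" "A \<longlonglongrightarrow> \<alpha>" "V \<longlonglongrightarrow> v"
    and pos: "\<beta> > 0" "\<alpha> > 0" "\<delta> > 0" and A: "\<And>k. 0 \<le> A k \<and> A k \<le> 1"
    and U: "\<And>k. U k \<in> normal_cone C (X k)"
    and accept: "\<And>k. \<not> ls_continue T C \<delta> (X k) (U k) (B k) (A k) (V k)"
    and H: "\<And>k. Y k \<in> H_half T (ls_point T C (X k) (U k) (B k) (A k)) (V k)"
  shows "x \<in> sol_set T C"
proof -
  have x: "x \<in> C"
    using X C(1) closed_sequentially by blast
  define Z where "Z k = ls_z T C (X k) (U k) (B k) (A k)" for k
  define P where "P k = ls_point T C (X k) (U k) (B k) (A k)" for k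
  define z where "z = ls_z T C x u \<beta> \<alpha>"
  define p where "p = ls_point T C x u \<beta> \<alpha>"
  have Z: "Z \<longlonglongrightarrow> z"
    unfolding Z_def z_def by (rule tendsto_ls_z[OF C T X x lims(1-3)])
  have P: "P \<longlonglongrightarrow> p"
    unfolding P_def p_def by (rule tendsto_ls_point[OF C T X x lims(1-3)])
  have PC: "P k \<in> C" for k
    unfolding P_def using C X(2) A by (intro ls_point_mem) auto
  then have "p \<in> C"
    using P C(1) closed_sequentially by blast
  then have TP: "(\<lambda>k. T (P k)) \<longlonglongrightarrow> T p"
    using continuous_on_tendsto_compose[OF T P] PC by simp
  have TX: "(\<lambda>k. T (X k)) \<longlonglongrightarrow> T x"
    using continuous_on_tendsto_compose[OF T X(1) x] X(2) by simp
  have "A k * (\<delta> * ((T (X k) + A k *\<^sub>R U k) \<bullet> (X k - Z k))) \<le> (T (P k) + V k) \<bullet> (X k - Y k)" for k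
  proof -
    have "A k * (\<delta> * ((T (X k) + A k *\<^sub>R U k) \<bullet> (X k - Z k)))
        \<le> A k * ((T (P k) + V k) \<bullet> (X k - Z k))"
      using accept[of k] A[of k] by (intro mult_left_mono) (auto simp: ls_continue_def Z_def P_def)
    \<comment> \<open>The trial point lies on the segment from \<open>X k\<close> to
      \<open>Z k\<close>, with \<open>X k - P k = A k *\<^sub>R (X k - Z k)\<close>.\<close>
    also have "\<dots> = (T (P k) + V k) \<bullet> (X k - P k)"
      by (simp add: P_def Z_def ls_point_def algebra_simps)
    also have "\<dots> = (T (P k) + V k) \<bullet> (X k - Y k) + (T (P k) + V k) \<bullet> (Y k - P k)"
      by (simp add: inner_diff_right)
    also have "\<dots> \<le> (T (P k) + V k) \<bullet> (X k - Y k)"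
      using H[of k] by (simp add: H_half_def P_def)
    finally show ?thesis .
  qed
  moreover have "(\<lambda>k. A k * (\<delta> * ((T (X k) + A k *\<^sub>R U k) \<bullet> (X k - Z k))))
      \<longlonglongrightarrow> \<alpha> * (\<delta> * ((T x + \<alpha> *\<^sub>R u) \<bullet> (x - z)))"
    by (intro tendsto_intros lims X Z TX)
  moreover have "(\<lambda>k. (T (P k) + V k) \<bullet> (X k - Y k)) \<longlonglongrightarrow> (T p + v) \<bullet> 0"
    by (intro tendsto_intros lims TP Y)
  ultimately have "\<alpha> * (\<delta> * ((T x + \<alpha> *\<^sub>R u) \<bullet> (x - z))) \<le> (T p + v) \<bullet> 0"
    by (intro LIMSEQ_le) auto
  then have "(T x + \<alpha> *\<^sub>R u) \<bullet> (x - z) \<le> 0"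
    using pos by (simp add: mult_le_0_iff)
  then have "\<beta> * ((T x + \<alpha> *\<^sub>R u) \<bullet> (x - z)) \<le> 0"
    using pos by (simp add: mult_le_0_iff)
  then have "(norm (x - z))\<^sup>2 \<le> 0"
    using norm_ls_z_le[OF C x, of T u \<beta> \<alpha>] unfolding z_def by linarith
  then have "z = x"
    by simp
  then show ?thesis
    using C x pos normal_cone_limit[OF X(1) lims(1) U]
    by (intro ls_z_fixed_imp_sol[of C x \<beta> \<alpha> u]) (auto simp: z_def)
qed

text \<open>As the rejected stepsizes vanish, the trial points collapse to \<open>x\<close>, and the
  limit \<open>v\<close> of their normals is normal at \<open>x\<close>. Rejection becomes an
  inequality between \<open>T x + v\<close> and \<delta> times \<open>T x\<close>, both paired with
  \<open>x - z\<close>. The \<open>v\<close> term is nonnegative because \<open>z\<close> lies in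
  \<open>C\<close>, so \<delta> < 1 forces the \<open>T x\<close> term to be at most 0.\<close>

lemma limit_sol_of_rejected_steps:
  assumes C: "closed C" "convex C" and T: "continuous_on C T"
    and X: "X \<longlonglongrightarrow> x" "\<And>k. X k \<in> C"
    and lims: "U \<longlonglongrightarrow> u" "B \<longlonglongrightarrow> \<beta>" "G \<longlonglongrightarrow> 0" "V \<longlonglongrightarrow> v"
    and pos: "\<beta> > 0" "\<delta> < 1" and G: "\<And>k. 0 \<le> G k \<and> G k \<le> 1"
    and V: "\<And>k. V k \<in> normal_cone C (ls_point T C (X k) (U k) (B k) (G k))"
    and reject: "\<And>k. ls_continue T C \<delta> (X k) (U k) (B k) (G k) (V k)"
  shows "x \<in> sol_set T C"
proof -
  have x: "x \<in> C"
    using X C(1) closed_sequentially by blast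
  define Z where "Z k = ls_z T C (X k) (U k) (B k) (G k)" for k
  define P where "P k = ls_point T C (X k) (U k) (B k) (G k)" for k
  define z where "z = ls_z T C x u \<beta> 0"
  have Z: "Z \<longlonglongrightarrow> z"
    unfolding Z_def z_def by (rule tendsto_ls_z[OF C T X x lims(1-3)])
  have P: "P \<longlonglongrightarrow> x"
    using tendsto_ls_point[OF C T X x lims(1-3)] unfolding P_def by (simp add: ls_point_def[of _ _ _ _ _ 0])
  have PC: "P k \<in> C" for k
    unfolding P_def using C X(2) G by (intro ls_point_mem) auto
  have TP: "(\<lambda>k. T (P k)) \<longlonglongrightarrow> T x"
    using continuous_on_tendsto_compose[OF T P x] PC by simp
  have TX: "(\<lambda>k. T (X k)) \<longlonglongrightarrow> T x"
    using continuous_on_tendsto_compose[OF T X(1) x] X(2) by simp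
  have "(\<lambda>k. (T (P k) + V k) \<bullet> (X k - Z k)) \<longlonglongrightarrow> (T x + v) \<bullet> (x - z)"
    by (intro tendsto_intros lims X Z TP)
  moreover have "(\<lambda>k. \<delta> * ((T (X k) + G k *\<^sub>R U k) \<bullet> (X k - Z k)))
      \<longlonglongrightarrow> \<delta> * ((T x + 0 *\<^sub>R u) \<bullet> (x - z))"
    by (intro tendsto_intros lims X Z TX)
  ultimately have le: "(T x + v) \<bullet> (x - z) \<le> \<delta> * ((T x + 0 *\<^sub>R u) \<bullet> (x - z))"
    using reject by (intro LIMSEQ_le) (auto simp: ls_continue_def Z_def P_def less_imp_le)
  have "v \<in> normal_cone C x"
    using normal_cone_limit[OF P lims(4)] V by (simp add: P_def)
  moreover have "z \<in> C"
    unfolding z_def using C x by (intro ls_z_mem) auto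
  ultimately have "v \<bullet> (z - x) \<le> 0"
    by (simp add: normal_cone_def)
  with le have "(1 - \<delta>) * (T x \<bullet> (x - z)) \<le> 0"
    by (simp add: algebra_simps)
  then have "T x \<bullet> (x - z) \<le> 0"
    using pos by (simp add: mult_le_0_iff)
  then have "\<beta> * (T x \<bullet> (x - z)) \<le> 0"
    using pos by (simp add: mult_le_0_iff)
  moreover have "(norm (x - z))\<^sup>2 \<le> \<beta> * (T x \<bullet> (x - z))"
    using norm_ls_z_le[OF C x, of T u \<beta> 0] by (simp add: z_def)
  ultimately have "(norm (x - z))\<^sup>2 \<le> 0"
    by linarith
  then have "z = x"
    by simp
  \<comment> \<open>At stepsize 0 the normal drops out of \<open>ls_z\<close>, so the zero vector,
    which lies in every normal cone, can replace \<open>u\<close>.\<close>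
  moreover have "ls_z T C x 0 \<beta> 0 = z"
    by (simp add: z_def ls_z_def)
  ultimately show ?thesis
    using C x pos by (intro ls_z_fixed_imp_sol[of C x \<beta> 0 0]) (auto simp: normal_cone_def)
qed

section \<open>The half-spaces \<open>H\<close> and \<open>W\<close>\<close>

text \<open>The dual inequality at \<open>p\<close> and the normal inequality at \<open>p\<close>,
  both tested at a solution, add up to membership in \<open>H\<close>. This is where the inclusion
  in the dual solution set enters.\<close>

lemma sol_set_subset_H_half:
  assumes "sol_set T C \<subseteq> dual_sol_set T C" "p \<in> C" "v \<in> normal_cone C p"
  shows "sol_set T C \<subseteq> H_half T p v"
proof
  fix s assume s: "s \<in> sol_set T C"
  then have "T p \<bullet> (p - s) \<ge> 0" "v \<bullet> (s - p) \<le> 0"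
    using assms by (auto simp: dual_sol_set_def sol_set_def normal_cone_def)
  then show "s \<in> H_half T p v"
    by (simp add: H_half_def algebra_simps)
qed

text \<open>Membership in \<open>W\<close> makes the angle at \<open>p\<close> in the triangle
  \<open>a\<close>, \<open>p\<close>, \<open>y\<close> right or obtuse; the law of cosines gives the
  inequality.\<close>

lemma W_half_dist:
  assumes "y \<in> W_half a p"
  shows "(dist p a)\<^sup>2 + (dist y p)\<^sup>2 \<le> (dist y a)\<^sup>2"
proof -
  have "(y - p) \<bullet> (a - p) \<le> 0"
    using assms by (simp add: W_half_def)
  moreover have "(dist y a)\<^sup>2 = (dist y p)\<^sup>2 + (dist p a)\<^sup>2 - 2 * ((y - p) \<bullet> (a - p))"
    by (simp add: dist_norm power2_norm_eq_inner inner_diff_left inner_diff_right inner_commute)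
  ultimately show ?thesis by simp
qed

lemma closed_H_half: "closed (H_half T p v)"
proof -
  have "H_half T p v = {y. (T p + v) \<bullet> y \<le> (T p + v) \<bullet> p}"
    by (auto simp: H_half_def algebra_simps)
  then show ?thesis by (simp add: closed_halfspace_le)
qed

lemma convex_H_half: "convex (H_half T p v)"
proof -
  have "H_half T p v = {y. (T p + v) \<bullet> y \<le> (T p + v) \<bullet> p}"
    by (auto simp: H_half_def algebra_simps)
  then show ?thesis by (simp add: convex_halfspace_le)
qed

lemma W_half_eq: "W_half a p = {y. (a - p) \<bullet> y \<le> (a - p) \<bullet> p}"
  by (auto simp: W_half_def inner_diff_left inner_diff_right inner_commute)

lemma closed_W_half: "closed (W_half a p)"
  by (simp add: W_half_eq closed_halfspace_le)

lemma convex_W_half: "convex (W_half a p)"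
  by (simp add: W_half_eq convex_halfspace_le)

section \<open>Convergence of the iterates\<close>

theorem theorem4p13:
  fixes T :: "real ^ 'n \<Rightarrow> real ^ 'n"
    and C :: "(real ^ 'n) set"
    and \<beta> :: "nat \<Rightarrow> real"
    and \<beta>_lo \<beta>_hi \<delta> \<theta> M :: real
    and x :: "nat \<Rightarrow> real ^ 'n"
  assumes "C \<noteq> {}" and "closed C" and "convex C"
    and "0 < \<beta>_lo" and "\<beta>_lo \<le> \<beta>_hi" and "\<And>k. \<beta> k \<in> {\<beta>_lo..\<beta>_hi}"
    and "\<delta> \<in> {0<..<1}" and "\<theta> \<in> {0<..<1}" and "M > 0"
    and "continuous_on C T"
    and "sol_set T C \<noteq> {}"
    and "sol_set T C \<subseteq> dual_sol_set T C"
    and "conceptual_algorithm_F T C \<beta> \<delta> \<theta> M (variant_F3 T C) x"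
    and "\<And>k. x k \<notin> sol_set T C"
  shows "x \<longlonglongrightarrow> closest_point (sol_set T C) (x 0)"
proof -
  note C = \<open>closed C\<close> \<open>convex C\<close> and T = \<open>continuous_on C T\<close>
  define S where "S = sol_set T C"
  have \<delta>: "0 < \<delta>" "\<delta> < 1" and \<theta>: "0 < \<theta>" "\<theta> < 1"
    using assms(7,8) by auto
  have x0: "x 0 \<in> C"
    using assms(13) by (simp add: conceptual_algorithm_F_def)
  \<comment> \<open>All choices of one iteration are gathered in one predicate, so that a single use
    of choice yields matching sequences of normals and stepsizes.\<close>
  define Q where "Q k u \<alpha> v \<longleftrightarrow> u \<in> normal_cone C (x k) \<and> norm u \<le> M \<and>
      ls_trial T C \<delta> \<theta> M (x k) u (\<beta> k) \<alpha> v \<and>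
      \<not> ls_continue T C \<delta> (x k) u (\<beta> k) \<alpha> v \<and>
      x (Suc k) = closest_point (C \<inter> H_half T (ls_point T C (x k) u (\<beta> k) \<alpha>) v
                  \<inter> W_half (x 0) (x k)) (x 0)" for k u \<alpha> v
  have "\<exists>u \<alpha> v. Q k u \<alpha> v" for k
  proof -
    obtain u \<alpha> z v where 1: "u \<in> normal_cone C (x k)" "norm u \<le> M"
        "linesearch_F T C \<delta> \<theta> M (x k) u (\<beta> k) \<alpha> z v"
        "x (Suc k) = variant_F3 T C (x 0) (x k) (\<alpha> *\<^sub>R z + (1 - \<alpha>) *\<^sub>R x k) v"
      using assms(13) unfolding conceptual_algorithm_F_def by blast
    then have "z = ls_z T C (x k) u (\<beta> k) \<alpha>"
      by (simp add: linesearch_F_def)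
    with 1 have "Q k u \<alpha> v"
      by (simp add: Q_def linesearch_F_def variant_F3_def ls_point_def)
    then show ?thesis by blast
  qed
  then obtain u \<alpha> v where Q: "\<And>k. Q k (u k) (\<alpha> k) (v k)"
    by metis
  have step: "\<And>k. u k \<in> normal_cone C (x k)" "\<And>k. norm (u k) \<le> M"
      "\<And>k. ls_trial T C \<delta> \<theta> M (x k) (u k) (\<beta> k) (\<alpha> k) (v k)"
      "\<And>k. \<not> ls_continue T C \<delta> (x k) (u k) (\<beta> k) (\<alpha> k) (v k)"
    and upd: "\<And>k. x (Suc k) = closest_point (C \<inter> H_half T (ls_point T C (x k) (u k) (\<beta> k) (\<alpha> k)) (v k)
                  \<inter> W_half (x 0) (x k)) (x 0)"
    using Q unfolding Q_def by blast+
  note \<alpha> = ls_trial_cases[OF step(3) \<theta>]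
  define A where "A k = C \<inter> H_half T (ls_point T C (x k) (u k) (\<beta> k) (\<alpha> k)) (v k) \<inter> W_half (x 0) (x k)" for k
  have xS: "x (Suc k) = closest_point (A k) (x 0)" for k
    by (simp add: upd A_def)
  have clA: "closed (A k)" and cvA: "convex (A k)" for k
    unfolding A_def using C
    by (auto intro!: closed_Int convex_Int closed_H_half convex_H_half closed_W_half convex_W_half)
  \<comment> \<open>Stated conditionally, so that it serves both inside the following induction and
    after it.\<close>
  have SA: "S \<subseteq> A k" if "x k \<in> C" "S \<subseteq> W_half (x 0) (x k)" for k
  proof -
    have "ls_point T C (x k) (u k) (\<beta> k) (\<alpha> k) \<in> C"
      using C that(1) \<alpha>(1,2)[of k] by (intro ls_point_mem) auto
    then have "S \<subseteq> H_half T (ls_point T C (x k) (u k) (\<beta> k) (\<alpha> k)) (v k)"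
      unfolding S_def using assms(12) \<alpha>(3) by (intro sol_set_subset_H_half)
    with that(2) show ?thesis
      by (auto simp: A_def S_def sol_set_def)
  qed
  \<comment> \<open>The two claims need each other: solutions in \<open>W\<close> keep
    \<open>A k\<close> nonempty, so the next iterate lies in \<open>A k\<close> and hence in
    \<open>C\<close>. The obtuse-angle property of that projection then places the solutions in the
    next \<open>W\<close>. At the start \<open>W\<close> is the whole space.\<close>
  have inv: "x k \<in> C \<and> S \<subseteq> W_half (x 0) (x k)" for k
  proof (induction k)
    case 0
    then show ?case using x0 by (simp add: W_half_def)
  next
    case (Suc k)
    then have sub: "S \<subseteq> A k"
      using SA by blast
    then have "A k \<noteq> {}"
      using assms(11) by (auto simp: S_def)
    then have "x (Suc k) \<in> A k"
      unfolding xS by (intro closest_point_in_set clA)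
    moreover have "s \<in> W_half (x 0) (x (Suc k))" if "s \<in> S" for s
      using closest_point_dot[OF cvA clA, of s k "x 0"] sub that
      by (auto simp: W_half_def xS inner_commute)
    ultimately show ?case
      by (auto simp: A_def)
  qed
  then have xC: "x k \<in> C" and SW: "S \<subseteq> W_half (x 0) (x k)" for k
    by auto
  have xA: "x (Suc k) \<in> A k" for k
  proof -
    have "A k \<noteq> {}"
      using SA[OF xC SW] assms(11) by (auto simp: S_def)
    then show ?thesis
      unfolding xS by (intro closest_point_in_set clA)
  qed
  define p where "p = closest_point S (x 0)"
  have clS: "closed S"
    unfolding S_def by (rule closed_sol_set[OF C(1) T])
  have pS: "p \<in> S"
    unfolding p_def using clS assms(11) by (auto simp: S_def intro: closest_point_in_set)
  define d where "d k = (dist (x k) (x 0))\<^sup>2" for k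
  \<comment> \<open>The same inequality is used for two points of \<open>W (x k)\<close>: the next
    iterate gives monotonicity with a quantified gap, the projection \<open>p\<close> gives the
    upper bound.\<close>
  have mono: "d k + (dist (x (Suc k)) (x k))\<^sup>2 \<le> d (Suc k)" for k
    unfolding d_def using xA[of k] by (intro W_half_dist) (simp add: A_def)
  have dp: "d k + (dist p (x k))\<^sup>2 \<le> (dist p (x 0))\<^sup>2" for k
    unfolding d_def using SW[of k] pS by (intro W_half_dist) auto
  have "incseq d"
    using mono by (intro incseq_SucI) (smt (verit) zero_le_power2)
  moreover have dle: "d k \<le> (dist p (x 0))\<^sup>2" for k
    using dp[of k] by (smt (verit) zero_le_power2)
  ultimately obtain L where L: "d \<longlonglongrightarrow> L"
    using incseq_convergent by metis
  have "(\<lambda>k. (dist (x (Suc k)) (x k))\<^sup>2) \<longlonglongrightarrow> 0"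
  proof (rule tendsto_sandwich[where f = "\<lambda>_. 0"])
    show "(\<lambda>k. d (Suc k) - d k) \<longlonglongrightarrow> 0"
      using tendsto_diff[OF LIMSEQ_Suc[OF L] L] by simp
    show "\<forall>\<^sub>F k in sequentially. (dist (x (Suc k)) (x k))\<^sup>2 \<le> d (Suc k) - d k"
      using mono by (auto simp: algebra_simps)
  qed auto
  then have "(\<lambda>k. sqrt ((dist (x (Suc k)) (x k))\<^sup>2)) \<longlonglongrightarrow> sqrt 0"
    by (rule tendsto_real_sqrt)
  then have diff: "(\<lambda>k. x k - x (Suc k)) \<longlonglongrightarrow> 0"
    by (simp add: dist_norm norm_minus_commute tendsto_norm_zero_iff)

  \<comment> \<open>A cluster point that is a solution\<close>
  define R where "R k w \<longleftrightarrow> norm w \<le> M \<and> (\<alpha> k = 1 \<or> \<alpha> k \<le> \<theta> \<and>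
      w \<in> normal_cone C (ls_point T C (x k) (u k) (\<beta> k) (\<alpha> k / \<theta>)) \<and>
      ls_continue T C \<delta> (x k) (u k) (\<beta> k) (\<alpha> k / \<theta>) w)" for k w
  have "\<exists>w. R k w" for k
  proof (cases "\<alpha> k = 1")
    case True
    \<comment> \<open>A full step has no rejected trial before it; the default 0 keeps
      \<open>w\<close> bounded by \<open>M\<close>, as the compactness argument requires.\<close>
    then have "R k 0"
      using \<open>M > 0\<close> by (simp add: R_def)
    then show ?thesis ..
  next
    case False
    then show ?thesis
      using \<alpha>(5)[of k] unfolding R_def by blast
  qed
  then obtain w where R: "\<And>k. R k (w k)"
    by metis
  have w: "norm (w k) \<le> M"
    "\<alpha> k = 1 \<or> \<alpha> k \<le> \<theta> \<and>
      w k \<in> normal_cone C (ls_point T C (x k) (u k) (\<beta> k) (\<alpha> k / \<theta>)) \<and>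
      ls_continue T C \<delta> (x k) (u k) (\<beta> k) (\<alpha> k / \<theta>) (w k)" for k
    using R[of k] unfolding R_def by blast+
  \<comment> \<open>Compactness of the product gives one subsequence along which all six sequences
    converge. The closed interval for \<beta> keeps its limit at least \<open>\<beta>_lo\<close>,
    hence positive.\<close>
  define K where "K = cball (x 0) (dist p (x 0)) \<times> cball (0 :: real ^ 'n) M \<times> cball (0 :: real ^ 'n) M
      \<times> cball (0 :: real ^ 'n) M \<times> {0..1::real} \<times> {\<beta>_lo..\<beta>_hi}"
  define D where "D k = (x k, u k, v k, w k, \<alpha> k, \<beta> k)" for k
  have "dist (x 0) (x k) \<le> dist p (x 0)" for k
    using dle[of k] power2_le_imp_le unfolding d_def by (metis dist_commute zero_le_dist)
  then have "\<forall>k. D k \<in> K"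
    using step(2) \<alpha>(1,2,4) w(1) assms(6) by (simp add: D_def K_def less_imp_le)
  moreover have "seq_compact K"
    unfolding K_def compact_eq_seq_compact_metric[symmetric] by (intro compact_Times) auto
  ultimately obtain l r where "l \<in> K" and r: "strict_mono r" and "(D \<circ> r) \<longlonglongrightarrow> l"
    unfolding seq_compact_def by metis
  moreover obtain x' u' v' w' \<alpha>' \<beta>' where l: "l = (x', u', v', w', \<alpha>', \<beta>')"
    by (cases l)
  ultimately have D: "(\<lambda>k. (x (r k), u (r k), v (r k), w (r k), \<alpha> (r k), \<beta> (r k)))
      \<longlonglongrightarrow> (x', u', v', w', \<alpha>', \<beta>')" and "0 \<le> \<alpha>'" "\<beta>_lo \<le> \<beta>'"
    by (auto simp: D_def K_def o_def)
  note D1 = tendsto_snd[OF D, simplified]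
  note D2 = tendsto_snd[OF D1, simplified]
  note D3 = tendsto_snd[OF D2, simplified]
  note D4 = tendsto_snd[OF D3, simplified]
  have lims: "(\<lambda>k. x (r k)) \<longlonglongrightarrow> x'" "(\<lambda>k. u (r k)) \<longlonglongrightarrow> u'" "(\<lambda>k. v (r k)) \<longlonglongrightarrow> v'"
    "(\<lambda>k. w (r k)) \<longlonglongrightarrow> w'" "(\<lambda>k. \<alpha> (r k)) \<longlonglongrightarrow> \<alpha>'" "(\<lambda>k. \<beta> (r k)) \<longlonglongrightarrow> \<beta>'"
    using tendsto_fst[OF D] tendsto_fst[OF D1] tendsto_fst[OF D2] tendsto_fst[OF D3]
      tendsto_fst[OF D4] tendsto_snd[OF D4] by simp_all
  have "\<beta>' > 0"
    using \<open>\<beta>_lo \<le> \<beta>'\<close> \<open>0 < \<beta>_lo\<close> by simp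
  have "x' \<in> sol_set T C"
  proof (cases "\<alpha>' = 0")
    case False
    with \<open>0 \<le> \<alpha>'\<close> have "\<alpha>' > 0" by simp
    have "(\<lambda>k. x (r k) - x (Suc (r k))) \<longlonglongrightarrow> 0"
      using LIMSEQ_subseq_LIMSEQ[OF diff r] by (simp add: o_def)
    moreover have "0 \<le> \<alpha> (r k) \<and> \<alpha> (r k) \<le> 1" for k
      using \<alpha>(1,2) by (simp add: less_imp_le)
    moreover have "x (Suc (r k))
        \<in> H_half T (ls_point T C (x (r k)) (u (r k)) (\<beta> (r k)) (\<alpha> (r k))) (v (r k))" for k
      using xA[of "r k"] by (simp add: A_def)
    ultimately show ?thesis
      by (intro limit_sol_of_positive_step[OF C T lims(1) xC _ lims(2,6,5,3) \<open>\<beta>' > 0\<close> \<open>\<alpha>' > 0\<close>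
            \<delta>(1) _ step(1) step(4)])
  next
    case True
    \<comment> \<open>Stepsizes tending to 0 are eventually below 1. After a shift by
      \<open>N\<close> every index has a rejected trial, and the rejected stepsizes, being larger by
      the fixed factor 1/\<theta>, tend to 0 too.\<close>
    have "\<forall>\<^sub>F k in sequentially. \<alpha> (r k) < 1"
      using order_tendstoD(2)[OF lims(5), of 1] True by simp
    then obtain N where N: "\<And>k. \<alpha> (r (k + N)) < 1"
      unfolding eventually_sequentially by (metis le_add2)
    define q where "q k = r (k + N)" for k
    have rej: "\<alpha> (q k) \<le> \<theta>"
      "w (q k) \<in> normal_cone C (ls_point T C (x (q k)) (u (q k)) (\<beta> (q k)) (\<alpha> (q k) / \<theta>))"
      "ls_continue T C \<delta> (x (q k)) (u (q k)) (\<beta> (q k)) (\<alpha> (q k) / \<theta>) (w (q k))" for k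
      using w(2)[of "q k"] N[of k] by (auto simp: q_def)
    have "(\<lambda>k. \<alpha> (q k) / \<theta>) \<longlonglongrightarrow> \<alpha>' / \<theta>"
      unfolding q_def using \<theta> by (intro tendsto_intros LIMSEQ_ignore_initial_segment lims) auto
    then have "(\<lambda>k. \<alpha> (q k) / \<theta>) \<longlonglongrightarrow> 0"
      using True by simp
    moreover have "0 \<le> \<alpha> (q k) / \<theta> \<and> \<alpha> (q k) / \<theta> \<le> 1" for k
      using rej(1)[of k] \<alpha>(1)[of "q k"] \<theta> by simp
    moreover note lims[THEN LIMSEQ_ignore_initial_segment[of _ _ N], folded q_def]
    ultimately show ?thesis
      by (intro limit_sol_of_rejected_steps[where X = "\<lambda>k. x (q k)" and U = "\<lambda>k. u (q k)"
            and B = "\<lambda>k. \<beta> (q k)" and V = "\<lambda>k. w (q k)", OF C T _ xC _ _ _ _ \<open>\<beta>' > 0\<close> \<delta>(2) _ rej(2,3)])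
  qed
  \<comment> \<open>As a solution, the cluster point is no closer to \<open>x 0\<close> than
    \<open>p\<close>. Its squared distance is the limit \<open>L\<close> of the whole sequence
    \<open>d\<close>, which is also bounded above by that of \<open>p\<close>; so \<open>L\<close>
    is exactly the latter.\<close>
  then have "dist (x 0) p \<le> dist (x 0) x'"
    unfolding p_def S_def using clS by (intro closest_point_le) (auto simp: S_def)
  moreover have "(\<lambda>k. d (r k)) \<longlonglongrightarrow> (dist x' (x 0))\<^sup>2"
    unfolding d_def by (intro tendsto_intros lims)
  then have "L = (dist x' (x 0))\<^sup>2"
    using LIMSEQ_subseq_LIMSEQ[OF L r] LIMSEQ_unique by (auto simp: o_def)
  ultimately have "(dist p (x 0))\<^sup>2 \<le> L"
    by (simp add: dist_commute)
  moreover have "L \<le> (dist p (x 0))\<^sup>2"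
    using L dle by (intro LIMSEQ_le_const2) auto
  ultimately have L: "d \<longlonglongrightarrow> (dist p (x 0))\<^sup>2"
    using L by simp
  have "(\<lambda>k. (dist p (x k))\<^sup>2) \<longlonglongrightarrow> 0"
  proof (rule tendsto_sandwich[where f = "\<lambda>_. 0"])
    show "(\<lambda>k. (dist p (x 0))\<^sup>2 - d k) \<longlonglongrightarrow> 0"
      using tendsto_diff[OF tendsto_const L, of "(dist p (x 0))\<^sup>2"] by simp
    show "\<forall>\<^sub>F k in sequentially. (dist p (x k))\<^sup>2 \<le> (dist p (x 0))\<^sup>2 - d k"
      using dp by (auto simp: algebra_simps)
  qed auto
  then have "(\<lambda>k. sqrt ((dist p (x k))\<^sup>2)) \<longlonglongrightarrow> sqrt 0"
    by (rule tendsto_real_sqrt)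
  then have "x \<longlonglongrightarrow> p"
    by (simp add: tendsto_dist_iff[of x] dist_commute)
  then show ?thesis
    by (simp add: p_def S_def)
qed

end
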